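(* Let $\zeta_5$ be a primitive fifth root of unity. Then \[ \sum_{n=0}^\infty\sum_{m=-\infty}^\infty\overline{M}(m,n)\zeta_5^mq^n=\sum_{r=0}^4 q^r\,\overline{M}_{r,5}(q^5), \] where \begin{align*} \overline{M}_{0,5}(q)&=\frac{(q^4,q^6,q^{10};q^{10})_\infty}{(q,q^4;q^5)_\infty(q^2,q^8;q^{10})_\infty}-q(\zeta_5+\zeta_5^4)\frac{(q^2,q^8,q^{10};q^{10})_\infty}{(q^2,q^3;q^5)_\infty(q^4,q^6;q^{10})_\infty},\\ \overline{M}_{1,5}(q)&=(\zeta_5+\zeta_5^4)\frac{(q^4,q^6,q^{10};q^{10})_\infty}{(q^2,q^3;q^5)_\infty(q^2,q^8;q^{10})_\infty},\\ \overline{M}_{2,5}(q)&=-\frac{(q^{10};q^{10})_\infty}{(q,q^4;q^5)_\infty},\\ \overline{M}_{3,5}(q)&=-(\zeta_5+\zeta_5^4)\frac{(q^{10};q^{10})_\infty}{(q^2,q^3;q^5)_\infty},\\ \overline{M}_{4,5}(q)&=-\frac{(q^2,q^8,q^{10};q^{10})_\infty}{(q,q^4;q^5)_\infty(q^4,q^6;q^{10})_\infty}. \end{align*}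
   Context: $(a;q)_\infty=\prod_{k\ge0}(1-aq^k)$ and $(a_1,\dots,a_j;q)_\infty=(a_1;q)_\infty\cdots(a_j;q)_\infty$. The numbers $\overline{M}(m,n)$ are defined by \[ \sum_{n\ge0}\sum_{m}\overline{M}(m,n)z^mq^n=\frac{(-q;q)_\infty(q;q)_\infty}{(zq;q)_\infty(z^{-1}q;q)_\infty}. \] *)

theory Defs
  imports "HOL-Analysis.Analysis"
begin

definition qpinf :: "complex \<Rightarrow> complex \<Rightarrow> complex" where
  "qpinf a q = (\<Prod>k. 1 - a * q ^ k)"

definition Mbar_gf :: "complex \<Rightarrow> complex \<Rightarrow> complex" where
  "Mbar_gf z q = qpinf (- q) q * qpinf q q / (qpinf (z * q) q * qpinf (q / z) q)"

definition Mbar :: "int \<Rightarrow> nat \<Rightarrow> int" where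
  "Mbar = (THE M. \<forall>z q :: complex. norm q < 1 \<and> norm q < norm z \<and> norm z * norm q < 1 \<longrightarrow>
      ((\<lambda>(m, n). of_int (M m n) * z powi m * q ^ n) has_sum Mbar_gf z q) UNIV)"

definition Mbar05 :: "complex \<Rightarrow> complex \<Rightarrow> complex" where
  "Mbar05 \<zeta> q =
     qpinf (q^4) (q^10) * qpinf (q^6) (q^10) * qpinf (q^10) (q^10)
       / (qpinf q (q^5) * qpinf (q^4) (q^5) * qpinf (q^2) (q^10) * qpinf (q^8) (q^10))
   - q * (\<zeta> + \<zeta>^4) *
     (qpinf (q^2) (q^10) * qpinf (q^8) (q^10) * qpinf (q^10) (q^10)
       / (qpinf (q^2) (q^5) * qpinf (q^3) (q^5) * qpinf (q^4) (q^10) * qpinf (q^6) (q^10)))"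

definition Mbar15 :: "complex \<Rightarrow> complex \<Rightarrow> complex" where
  "Mbar15 \<zeta> q = (\<zeta> + \<zeta>^4) *
     (qpinf (q^4) (q^10) * qpinf (q^6) (q^10) * qpinf (q^10) (q^10)
       / (qpinf (q^2) (q^5) * qpinf (q^3) (q^5) * qpinf (q^2) (q^10) * qpinf (q^8) (q^10)))"

definition Mbar25 :: "complex \<Rightarrow> complex \<Rightarrow> complex" where
  "Mbar25 \<zeta> q = - (qpinf (q^10) (q^10) / (qpinf q (q^5) * qpinf (q^4) (q^5)))"

definition Mbar35 :: "complex \<Rightarrow> complex \<Rightarrow> complex" where
  "Mbar35 \<zeta> q = - (\<zeta> + \<zeta>^4) * (qpinf (q^10) (q^10) / (qpinf (q^2) (q^5) * qpinf (q^3) (q^5)))"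

definition Mbar45 :: "complex \<Rightarrow> complex \<Rightarrow> complex" where
  "Mbar45 \<zeta> q = -
     (qpinf (q^2) (q^10) * qpinf (q^8) (q^10) * qpinf (q^10) (q^10)
       / (qpinf q (q^5) * qpinf (q^4) (q^5) * qpinf (q^4) (q^10) * qpinf (q^6) (q^10)))"

end

theory Submission
  imports Defs "HOL-Complex_Analysis.Cauchy_Integral_Formula"
begin

text \<open>
  For a fifth root of unity $\zeta \neq 1$, the product of $(\zeta^j q;q)_\infty$ over $j < 5$ is
  $(q^5;q^5)_\infty$, so $1/((\zeta q;q)_\infty(q/\zeta;q)_\infty)$ equals
  $T(\zeta^2)/(q^5;q^5)_\infty$ with
  $T(\zeta) = (\zeta q;q)_\infty(q/\zeta;q)_\infty(q;q)_\infty$. Splitting the theta series of the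
  Jacobi triple product by residues modulo 5 gives a two-term dissection
  $T(\zeta) = A(q^5) + q(\zeta^2+\zeta^3)B(q^5)$. The same dissection at $q^2$, for $\zeta$ and
  $\zeta^2$, multiplies out to a three-term dissection of $(q^2;q^2)_\infty = (-q;q)_\infty(q;q)_\infty$.
  The product of the two dissections has six terms, which are the claimed ones.
\<close>

section \<open>Infinite q-products and Euler's expansions\<close>

text \<open>\<open>Mbar\<close> is a definite description, so the product identity alone says
  nothing about it: an integer array with the given generating function must be shown to exist and
  to be unique on |q| < |z| < 1/|q|. The circle |z| = 1 lies in this annulus whenever |q| < 1, which
  allows z = \<zeta>. Integrality does real work: finite support makes both the regrouping of terms
  and the identity theorem in z elementary. On the product side everything rests on a = \<zeta> +
  \<zeta>^4 and b = \<zeta>^2 + \<zeta>^3 satisfying a + b = ab = -1. The conjugate dissections A +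
  qbB and A + qaB therefore multiply to A^2 - qAB - q^2 B^2, free of \<zeta>. At q^2 this has
  explicit q-exponents 0, 2, 4, while the other factor has 0, 1; their sums are 0, ..., 5, and 5
  falls back into the class of 0. Hence \<open>Mbar05\<close> alone has two terms, the second with a
  factor q.\<close>

lemma convergent_prod_qpinf:
  fixes a q :: complex
  assumes "norm q < 1"
  shows "convergent_prod (\<lambda>k. 1 - a * q ^ k)"
proof (rule abs_convergent_prod_imp_convergent_prod, rule summable_imp_abs_convergent_prod)
  show "summable (\<lambda>k. norm (1 - a * q ^ k - 1))"
    using assms by (auto simp: norm_mult norm_power intro!: summable_mult summable_geometric)
qed

lemma qpinf_LIMSEQ:
  assumes "norm q < 1"
  shows "(\<lambda>n. \<Prod>k<n. 1 - a * q ^ k) \<longlonglongrightarrow> qpinf a q"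
  unfolding qpinf_def
  using convergent_prod_LIMSEQ[OF convergent_prod_qpinf[OF assms, of a]]
  by (simp add: LIMSEQ_lessThan_iff_atMost)

lemma qpinf_unique:
  assumes "norm q < 1" "(\<lambda>n. \<Prod>k<n. 1 - a * q ^ k) \<longlonglongrightarrow> L"
  shows "qpinf a q = L"
  using LIMSEQ_unique[OF qpinf_LIMSEQ[OF assms(1)] assms(2)] .

lemma qpinf_0 [simp]: "qpinf 0 q = 1"
  by (simp add: qpinf_def)

lemma qpinf_split:
  assumes "norm q < 1"
  shows "qpinf a q = (\<Prod>k<m. 1 - a * q ^ k) * qpinf (a * q ^ m) q"
proof (rule qpinf_unique[OF assms])
  have "(\<lambda>n. (\<Prod>k<m. 1 - a * q ^ k) * (\<Prod>k<n. 1 - (a * q ^ m) * q ^ k))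
          \<longlonglongrightarrow> (\<Prod>k<m. 1 - a * q ^ k) * qpinf (a * q ^ m) q"
    by (intro tendsto_intros qpinf_LIMSEQ assms)
  also have "(\<lambda>n. (\<Prod>k<m. 1 - a * q ^ k) * (\<Prod>k<n. 1 - (a * q ^ m) * q ^ k)) =
             (\<lambda>n. \<Prod>k<n+m. 1 - a * q ^ k)"
  proof
    fix n
    have "(\<Prod>k<m+n. 1 - a * q ^ k) = (\<Prod>k<m. 1 - a * q ^ k) * (\<Prod>k=m..<m+n. 1 - a * q ^ k)"
      using prod.atLeastLessThan_concat[of 0 m "m+n" "\<lambda>k. 1 - a * q ^ k"]
      by (simp add: atLeast0LessThan)
    also have "(\<Prod>k=m..<m+n. 1 - a * q ^ k) = (\<Prod>k<n. 1 - (a * q ^ m) * q ^ k)"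
      using prod.shift_bounds_nat_ivl[of "\<lambda>k. 1 - a * q ^ k" 0 m n]
      by (simp add: atLeast0LessThan power_add mult_ac add_ac)
    finally show "(\<Prod>k<m. 1 - a * q ^ k) * (\<Prod>k<n. 1 - (a * q ^ m) * q ^ k) =
                  (\<Prod>k<n+m. 1 - a * q ^ k)"
      by (simp add: add.commute)
  qed
  finally show "(\<lambda>n. \<Prod>k<n. 1 - a * q ^ k) \<longlonglongrightarrow> (\<Prod>k<m. 1 - a * q ^ k) * qpinf (a * q ^ m) q"
    by (rule LIMSEQ_offset)
qed

lemma qpinf_Suc:
  assumes "norm q < 1"
  shows "qpinf a q = (1 - a) * qpinf (a * q) q"
  using qpinf_split[OF assms, of a 1] by simp

lemma qpinf_1 [simp]: "norm q < 1 \<Longrightarrow> qpinf 1 q = 0"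
  by (subst qpinf_Suc) auto

lemma qpinf_nonzero:
  assumes "norm q < 1" "norm a < 1"
  shows "qpinf a q \<noteq> 0"
  unfolding qpinf_def
proof (rule prodinf_nonzero[OF convergent_prod_qpinf[OF assms(1)]])
  fix k
  have "norm (a * q ^ k) \<le> norm a * 1"
    unfolding norm_mult norm_power
    by (intro mult_left_mono power_le_one) (use assms in auto)
  hence "norm (a * q ^ k) < 1" using assms by simp
  thus "1 - a * q ^ k \<noteq> 0" by auto
qed

lemma power_less_one_norm:
  fixes q :: complex
  assumes "norm q < 1" "n > 0"
  shows "norm (q ^ n) < 1"
  using assms by (simp add: norm_power power_less_one_iff)

text \<open>Sorting the exponents by residue modulo d is a finite rearrangement once the partial
  products are cut at multiples of d, so the limit is taken along the subsequence
  \<open>n * d\<close>.\<close>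

lemma qpinf_multisect:
  assumes "norm q < 1" "d > 0"
  shows "qpinf a q = (\<Prod>r<d. qpinf (a * q ^ r) (q ^ d))"
proof -
  have *: "(\<Prod>k<n*d. 1 - a * q ^ k) = (\<Prod>r<d. \<Prod>k<n. 1 - (a * q ^ r) * (q ^ d) ^ k)" for n
  proof (induction n)
    case (Suc n)
    have "(\<Prod>k<Suc n*d. 1 - a * q ^ k) =
          (\<Prod>k<n*d. 1 - a * q ^ k) * (\<Prod>k=n*d..<n*d+d. 1 - a * q ^ k)"
      using prod.atLeastLessThan_concat[of 0 "n*d" "n*d+d" "\<lambda>k. 1 - a * q ^ k"]
      by (simp add: atLeast0LessThan add.commute)
    also have "(\<Prod>k=n*d..<n*d+d. 1 - a * q ^ k) = (\<Prod>r<d. 1 - (a * q ^ r) * (q ^ d) ^ n)"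
      using prod.shift_bounds_nat_ivl[of "\<lambda>k. 1 - a * q ^ k" 0 "n*d" d]
      by (simp add: atLeast0LessThan power_add mult_ac add_ac flip: power_mult)
    finally show ?case
      by (simp add: Suc.IH prod.distrib)
  qed simp
  have "(\<lambda>n. \<Prod>r<d. \<Prod>k<n. 1 - (a * q ^ r) * (q ^ d) ^ k) \<longlonglongrightarrow> (\<Prod>r<d. qpinf (a * q ^ r) (q ^ d))"
    by (intro tendsto_prod qpinf_LIMSEQ power_less_one_norm assms)
  moreover have "(\<lambda>n. \<Prod>k<n*d. 1 - a * q ^ k) \<longlonglongrightarrow> qpinf a q"
    using filterlim_compose[OF qpinf_LIMSEQ[OF assms(1), of a] mult_nat_right_at_top[of d]] assms(2)
    by simp
  ultimately show ?thesis
    unfolding * using LIMSEQ_unique by blast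
qed

lemma qpinf_minus_mult:
  assumes "norm q < 1"
  shows "qpinf (- a) q * qpinf a q = qpinf (a ^ 2) (q ^ 2)"
  unfolding qpinf_def
proof (subst prodinf_mult)
  show "(\<Prod>n. (1 - - a * q ^ n) * (1 - a * q ^ n)) = (\<Prod>k. 1 - a\<^sup>2 * (q\<^sup>2) ^ k)"
    by (rule prodinf_cong) (simp add: algebra_simps power2_eq_square power_mult_distrib)
qed (rule convergent_prod_qpinf[OF assms])+

definition qpoch :: "complex \<Rightarrow> nat \<Rightarrow> complex" where
  "qpoch q m = (\<Prod>k<m. 1 - q ^ Suc k)"

lemma qpoch_0 [simp]: "qpoch q 0 = 1"
  and qpoch_Suc: "qpoch q (Suc m) = qpoch q m * (1 - q ^ Suc m)"
  by (simp_all add: qpoch_def)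

lemma qpoch_nonzero:
  assumes "norm q < 1"
  shows "qpoch q m \<noteq> 0"
proof -
  have "norm (q ^ Suc k) < 1" for k
    using power_less_one_norm[OF assms, of "Suc k"] by simp
  hence "1 - q ^ Suc k \<noteq> 0" for k
    by (metis diff_eq_diff_eq diff_self less_irrefl norm_one right_minus_eq)
  thus ?thesis by (simp add: qpoch_def)
qed

lemma qpinf_eq_qpoch:
  assumes "norm q < 1"
  shows "qpinf q q = qpoch q m * qpinf (q ^ Suc m) q"
  using qpinf_split[OF assms, of q m] by (simp add: qpoch_def)

text \<open>The reciprocals converge, because the limit \<open>qpinf q q\<close> is nonzero. A bound
  uniform in m lets the denominators in Euler's series be ignored in every comparison test.\<close>

lemma qpoch_inverse_bounded:
  assumes "norm q < 1"
  obtains C where "C > 0" "\<And>m. norm (1 / qpoch q m) \<le> C"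
proof -
  have "(\<lambda>m. 1 / qpoch q m) \<longlonglongrightarrow> 1 / qpinf q q"
    using qpinf_LIMSEQ[OF assms, of q] qpinf_nonzero[OF assms assms]
    by (auto intro!: tendsto_divide simp: qpoch_def)
  hence "Bseq (\<lambda>m. 1 / qpoch q m)"
    by (rule convergentI[THEN convergent_imp_Bseq])
  thus ?thesis
    using that by (auto simp: Bseq_def)
qed

text \<open>In both of Euler's expansions the two sides solve the same first-order q-difference equation,
  and iterating it pushes the argument to 0.\<close>

lemma q_difference_limit:
  fixes c :: "nat \<Rightarrow> complex"
  assumes q: "norm q < 1" and r: "r > 0"
    and F: "\<And>x. norm x < r \<Longrightarrow> (\<lambda>n. c n * x ^ n) sums F x" and c0: "c 0 = 1"
  shows "(\<lambda>n. F (x * q ^ n)) \<longlonglongrightarrow> 1"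
proof -
  have "isCont F 0"
  proof -
    have "F \<midarrow>0\<rightarrow> c 0"
      by (rule powser_limit_0[OF r F])
    moreover have "F 0 = c 0"
      using F[of 0] r by (metis norm_zero powser_sums_zero sums_unique2)
    ultimately show ?thesis by (simp add: isCont_def)
  qed
  moreover have "(\<lambda>n. x * q ^ n) \<longlonglongrightarrow> 0"
    using LIMSEQ_power_zero[OF q] tendsto_mult_right_zero by blast
  moreover have "F 0 = 1"
    using F[of 0] r c0 by (metis norm_zero powser_sums_zero sums_unique2)
  ultimately show ?thesis
    using isCont_tendsto_compose by metis
qed

lemma euler_summable1:
  assumes "norm q < 1" "norm x < 1"
  shows "summable (\<lambda>m. norm (x ^ m / qpoch q m))"
proof -
  obtain C where C: "C > 0" "\<And>m. norm (1 / qpoch q m) \<le> C"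
    using qpoch_inverse_bounded[OF assms(1)] by blast
  show ?thesis
  proof (rule summable_comparison_test')
    show "summable (\<lambda>m. C * norm x ^ m)"
      using assms by (intro summable_mult summable_geometric) auto
    show "norm (norm (x ^ m / qpoch q m)) \<le> C * norm x ^ m" for m
      using mult_right_mono[OF C(2)[of m], of "norm x ^ m"]
      by (simp add: norm_divide norm_power)
  qed
qed

lemma euler1:
  assumes q: "norm q < 1" and x: "norm x < 1"
  shows "(\<lambda>m. x ^ m / qpoch q m) sums (1 / qpinf x q)"
proof -
  define F where "F x = (\<Sum>m. x ^ m / qpoch q m)" for x
  have F: "(\<lambda>m. x ^ m / qpoch q m) sums F x" if "norm x < 1" for x
    unfolding F_def by (rule summable_sums[OF summable_norm_cancel[OF euler_summable1[OF q that]]])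
  have nx: "norm (x * q) < 1" if "norm x < 1" for x
  proof -
    have "norm x * norm q \<le> norm x * 1" by (rule mult_left_mono) (use q in auto)
    thus ?thesis using that by (simp add: norm_mult)
  qed
  have rec: "F (x * q) = F x * (1 - x)" if "norm x < 1" for x
  proof -
    have "(\<lambda>m. x ^ m / qpoch q m - (x * q) ^ m / qpoch q m) sums (F x - F (x * q))"
      by (intro sums_diff F nx that)
    \<comment> \<open>The two terms of index 0 cancel, so the index can be shifted; the factor
      \<open>1 - q ^ Suc m\<close> then removes the last factor of
      \<open>qpoch q (Suc m)\<close>.\<close>
    hence "(\<lambda>m. x ^ Suc m / qpoch q (Suc m) - (x * q) ^ Suc m / qpoch q (Suc m)) sums (F x - F (x * q))"
      by (subst sums_Suc_iff) simp
    also have "(\<lambda>m. x ^ Suc m / qpoch q (Suc m) - (x * q) ^ Suc m / qpoch q (Suc m)) =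
               (\<lambda>m. x * (x ^ m / qpoch q m))"
    proof
      fix m
      have "x ^ Suc m / qpoch q (Suc m) - (x * q) ^ Suc m / qpoch q (Suc m) =
            x ^ Suc m * (1 - q ^ Suc m) / qpoch q (Suc m)"
        by (simp only: power_mult_distrib diff_divide_distrib right_diff_distrib mult_1_right)
      also have "\<dots> = x * (x ^ m / qpoch q m)"
        using qpoch_nonzero[OF q, of "Suc m"] unfolding qpoch_Suc by simp
      finally show "x ^ Suc m / qpoch q (Suc m) - (x * q) ^ Suc m / qpoch q (Suc m) =
                    x * (x ^ m / qpoch q m)" .
    qed
    finally have "F x - F (x * q) = x * F x"
      using sums_unique2 sums_mult[OF F[OF that], of x] by blast
    thus ?thesis by (simp add: algebra_simps)
  qed
  have nn: "norm (x * q ^ n) < 1" for n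
  proof (induction n)
    case (Suc n)
    thus ?case using nx[of "x * q ^ n"] by (simp add: mult_ac)
  qed (use x in simp)
  have it: "F (x * q ^ n) = F x * (\<Prod>k<n. 1 - x * q ^ k)" for n
  proof (induction n)
    case (Suc n)
    show ?case using rec[OF nn[of n]] Suc by (simp add: mult_ac)
  qed simp
  have "(\<lambda>n. F (x * q ^ n)) \<longlonglongrightarrow> 1"
    by (rule q_difference_limit[where c = "\<lambda>m. 1 / qpoch q m" and r = 1, OF q]) (use F in auto)
  moreover have "(\<lambda>n. F (x * q ^ n)) \<longlonglongrightarrow> F x * qpinf x q"
    unfolding it by (intro tendsto_intros qpinf_LIMSEQ q)
  ultimately have "F x * qpinf x q = 1"
    using LIMSEQ_unique by blast
  hence "F x = 1 / qpinf x q"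
    using qpinf_nonzero[OF q x] by (simp add: field_simps)
  thus ?thesis using F[OF x] by simp
qed

lemma Suc_choose_two: "Suc n choose 2 = n + (n choose 2)"
  by (simp add: numeral_2_eq_2)

text \<open>The ratio of successive terms has norm |x| |q|^n, which tends to 0 whatever x
  is.\<close>

lemma summable_power_choose_two:
  fixes q x :: complex
  assumes "norm q < 1"
  shows "summable (\<lambda>n. norm (q ^ (n choose 2) * x ^ n))"
proof -
  have "(\<lambda>n. norm x * norm q ^ n) \<longlonglongrightarrow> norm x * 0"
    using assms by (intro tendsto_intros LIMSEQ_power_zero) auto
  hence "eventually (\<lambda>n. norm x * norm q ^ n < 1 / 2) sequentially"
    by (intro order_tendstoD) auto
  then obtain N where N: "\<And>n. n \<ge> N \<Longrightarrow> norm x * norm q ^ n < 1 / 2"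
    by (auto simp: eventually_at_top_linorder)
  show ?thesis
  proof (rule summable_ratio_test[of "1/2" N])
    fix n assume "n \<ge> N"
    have "norm (norm (q ^ (Suc n choose 2) * x ^ Suc n)) =
          (norm x * norm q ^ n) * norm (q ^ (n choose 2) * x ^ n)"
      by (simp add: Suc_choose_two power_add norm_mult norm_power)
    also have "\<dots> \<le> 1/2 * norm (q ^ (n choose 2) * x ^ n)"
      by (rule mult_right_mono) (use N[OF \<open>n \<ge> N\<close>] in auto)
    finally show "norm (norm (q ^ (Suc n choose 2) * x ^ Suc n)) \<le>
                  1/2 * norm (norm (q ^ (n choose 2) * x ^ n))" by simp
  qed auto
qed

lemma euler_summable2:
  assumes "norm q < 1"
  shows "summable (\<lambda>m. norm ((-1) ^ m * q ^ (m choose 2) * x ^ m / qpoch q m))"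
proof -
  obtain C where C: "C > 0" "\<And>m. norm (1 / qpoch q m) \<le> C"
    using qpoch_inverse_bounded[OF assms(1)] by blast
  show ?thesis
  proof (rule summable_comparison_test')
    show "summable (\<lambda>m. C * norm (q ^ (m choose 2) * x ^ m))"
      using assms by (intro summable_mult summable_power_choose_two)
    show "norm (norm ((-1) ^ m * q ^ (m choose 2) * x ^ m / qpoch q m)) \<le>
          C * norm (q ^ (m choose 2) * x ^ m)" for m
      using mult_right_mono[OF C(2)[of m], of "norm (q ^ (m choose 2) * x ^ m)"]
      by (simp add: norm_divide norm_mult norm_power)
  qed
qed

text \<open>The quadratic exponent makes the series entire in x. This matters for the triple
  product, where x is a power of q with an arbitrary, possibly negative, exponent.\<close>

lemma euler2:
  assumes q: "norm q < 1"
  shows "(\<lambda>m. (-1) ^ m * q ^ (m choose 2) * x ^ m / qpoch q m) sums qpinf x q"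
proof -
  define c where "c m = (-1) ^ m * q ^ (m choose 2) / qpoch q m" for m
  define G where "G x = (\<Sum>m. c m * x ^ m)" for x
  have G: "(\<lambda>m. c m * x ^ m) sums G x" for x
    unfolding G_def c_def
    using summable_sums[OF summable_norm_cancel[OF euler_summable2[OF q, of x]]] by simp
  have rec: "G x = (1 - x) * G (x * q)" for x
  proof -
    have "(\<lambda>m. c m * x ^ m - c m * (x * q) ^ m) sums (G x - G (x * q))"
      by (intro sums_diff G)
    hence "(\<lambda>m. c (Suc m) * x ^ Suc m - c (Suc m) * (x * q) ^ Suc m) sums (G x - G (x * q))"
      by (subst sums_Suc_iff) (simp add: c_def)
    also have "(\<lambda>m. c (Suc m) * x ^ Suc m - c (Suc m) * (x * q) ^ Suc m) =
               (\<lambda>m. - x * (c m * (x * q) ^ m))"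
    proof
      fix m
      have "c (Suc m) * x ^ Suc m - c (Suc m) * (x * q) ^ Suc m =
            c (Suc m) * (1 - q ^ Suc m) * x ^ Suc m"
        by (simp add: power_mult_distrib algebra_simps)
      also have "c (Suc m) * (1 - q ^ Suc m) = - c m * q ^ m"
        using qpoch_nonzero[OF q, of "Suc m"] unfolding qpoch_Suc c_def Suc_choose_two
        by (simp add: power_add)
      finally show "c (Suc m) * x ^ Suc m - c (Suc m) * (x * q) ^ Suc m =
                    - x * (c m * (x * q) ^ m)"
        by (simp add: power_mult_distrib)
    qed
    finally have "G x - G (x * q) = - x * G (x * q)"
      using sums_unique2 sums_mult[OF G, of "-x" "x * q"] by blast
    thus ?thesis by (simp add: algebra_simps)
  qed
  have it: "G x = (\<Prod>k<n. 1 - x * q ^ k) * G (x * q ^ n)" for n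
  proof (induction n)
    case (Suc n)
    show ?case using rec[of "x * q ^ n"] Suc by (simp add: mult_ac)
  qed simp
  have "(\<lambda>n. G (x * q ^ n)) \<longlonglongrightarrow> 1"
    by (rule q_difference_limit[where c = c and r = 1, OF q]) (use G in \<open>auto simp: c_def numeral_2_eq_2\<close>)
  hence "(\<lambda>n. (\<Prod>k<n. 1 - x * q ^ k) * G (x * q ^ n)) \<longlonglongrightarrow> qpinf x q * 1"
    by (intro tendsto_intros qpinf_LIMSEQ q)
  hence "G x = qpinf x q"
    by (simp flip: it add: LIMSEQ_const_iff)
  thus ?thesis using G[of x] by (simp add: c_def)
qed

section \<open>The Jacobi triple product\<close>

text \<open>For complex families, summability is absolute summability, so the product family is
  absolutely summable and the iterated sum is the double sum.\<close>

lemma has_sum_Times_mult: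
  fixes f :: "'a \<Rightarrow> complex" and g :: "'b \<Rightarrow> complex"
  assumes f: "(f has_sum a) A" and g: "(g has_sum b) B"
  shows "((\<lambda>(x, y). f x * g y) has_sum a * b) (A \<times> B)"
proof (rule has_sum_SigmaI)
  show "((\<lambda>y. case (x, y) of (x, y) \<Rightarrow> f x * g y) has_sum f x * b) B" for x
    by (simp add: has_sum_cmult_right g)
  show "((\<lambda>x. f x * b) has_sum a * b) A"
    by (rule has_sum_cmult_left[OF f])
  have f': "(\<lambda>x. norm (f x)) summable_on A" and g': "(\<lambda>x. norm (g x)) summable_on B"
    using f g has_sum_imp_summable summable_on_iff_abs_summable_on_complex by blast+
  have "(\<lambda>p. norm (case p of (x, y) \<Rightarrow> f x * g y)) summable_on A \<times> B"
    unfolding Infinite_Sum.abs_summable_on_Sigma_iff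
    using f' g' by (auto simp: norm_mult infsum_cmult_right' infsum_nonneg abs_mult
        intro!: summable_on_cmult_right summable_on_cmult_left)
  thus "(\<lambda>(x, y). f x * g y) summable_on A \<times> B"
    by (rule abs_summable_summable)
qed

definition theta_term :: "complex \<Rightarrow> complex \<Rightarrow> int \<Rightarrow> complex" where
  "theta_term z q n = (-1) powi n * z powi n * q powi (n * (n - 1) div 2)"

lemma int_choose_two: "int (n choose 2) = int n * (int n - 1) div 2"
proof (cases n)
  case (Suc k)
  thus ?thesis by (simp add: choose_two zdiv_int algebra_simps)
qed simp

lemma theta_term_nat: "theta_term z q (int n) = (-1) ^ n * q ^ (n choose 2) * z ^ n"
  by (simp add: theta_term_def flip: int_choose_two)

text \<open>Reflecting n to -n turns n(n-1)/2 into n(n-1)/2 + n. The extra \<open>q ^ n\<close> is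
  absorbed by passing from z to q/z, so the negative half of the theta series looks like the
  nonnegative one.\<close>

lemma theta_term_minus_nat:
  "theta_term z q (- int n) = (-1) ^ n * q ^ (n choose 2) * (q / z) ^ n"
proof -
  have "(- int n) * (- int n - 1) div 2 = int ((Suc n) choose 2)"
    by (simp add: int_choose_two algebra_simps)
  also have "\<dots> = int ((n choose 2) + n)"
    by (simp add: Suc_choose_two)
  finally show ?thesis
    unfolding theta_term_def
    by (simp only: power_int_of_nat power_int_minus power_add)
       (cases "even n"; simp add: divide_inverse power_mult_distrib power_inverse mult_ac)
qed

text \<open>The cross term nm of the quadratic exponent becomes the m-th power of
  \<open>q powi n\<close>, so as a function of m the shifted term has the shape of Euler's second
  series at argument \<open>z * q powi n\<close>.\<close>

lemma theta_term_add_nat: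
  assumes "q \<noteq> 0" "z \<noteq> 0"
  shows "theta_term z q (n + int m) =
           theta_term z q n * ((-1) ^ m * q ^ (m choose 2) * (z * q powi n) ^ m)"
proof -
  have "(n + int m) * (n + int m - 1) =
        n * (n - 1) + 2 * (n * int m) + int m * (int m - 1)"
    by (simp add: algebra_simps)
  moreover have "2 dvd n * (n - 1)" "2 dvd int m * (int m - 1)"
    by auto
  ultimately have "(n + int m) * (n + int m - 1) div 2 =
       n * (n - 1) div 2 + n * int m + int (m choose 2)"
    unfolding int_choose_two by (auto elim!: dvdE)
  hence "q powi ((n + int m) * (n + int m - 1) div 2) =
         q powi (n * (n - 1) div 2) * (q powi n) ^ m * q ^ (m choose 2)"
    using assms by (simp add: power_int_add power_int_mult)
  thus ?thesis
    using assms unfolding theta_term_def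
    by (simp add: power_int_add power_mult_distrib)
qed

lemma theta_term_summable:
  assumes "norm q < 1"
  shows "theta_term z q summable_on UNIV"
proof -
  have s: "(\<lambda>n. (-1) ^ n * q ^ (n choose 2) * x ^ n) summable_on UNIV" for x
    by (rule norm_summable_imp_summable_on)
       (use summable_power_choose_two[OF assms, of x] in \<open>simp add: norm_mult norm_power\<close>)
  have "theta_term z q summable_on range int"
    using s[of z] by (subst summable_on_reindex) (auto simp: o_def theta_term_nat)
  moreover have "theta_term z q summable_on range (\<lambda>n. - int n)"
    using s[of "q / z"] by (subst summable_on_reindex) (auto simp: o_def theta_term_minus_nat inj_def)
  moreover have "range int \<union> range (\<lambda>n. - int n) = UNIV"
    by (auto simp: image_iff) (metis int_cases2)
  ultimately show ?thesis
    using summable_on_union by metis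
qed

text \<open>Expand the product of 1/(q/z;q) (by Euler) with the theta series as a double sum and shift
  the index of the theta series: the inner sums become Euler expansions of the q-shifted
  factorial at q^(n+1), which vanishes for negative n.\<close>

theorem jacobi_triple_product:
  assumes q: "norm q < 1" "q \<noteq> 0" and z: "norm q < norm z"
  shows "(theta_term z q has_sum (qpinf z q * qpinf (q / z) q * qpinf q q)) UNIV"
proof -
  have z0: "z \<noteq> 0" and qz: "norm (q / z) < 1"
    using z by (auto simp: norm_divide divide_simps)
  define T where "T = infsum (theta_term z q) UNIV"
  define a where "a m = (q / z) ^ m / qpoch q m" for m
  have T: "(theta_term z q has_sum T) UNIV"
    unfolding T_def by (rule has_sum_infsum[OF theta_term_summable[OF q(1)]])
  have a: "(a has_sum (1 / qpinf (q / z) q)) UNIV"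
    unfolding a_def by (intro norm_summable_imp_has_sum euler_summable1 euler1 q qz)
  have E2: "((\<lambda>m. (-1) ^ m * q ^ (m choose 2) * x ^ m / qpoch q m) has_sum qpinf x q) UNIV" for x
    by (intro norm_summable_imp_has_sum euler_summable2 euler2 q)
  \<comment> \<open>The factor \<open>(q / z) ^ m\<close> of \<open>a m\<close> cancels
    \<open>z ^ m\<close> and raises \<open>q powi n\<close> to \<open>q powi (n + 1)\<close>; the
    Euler argument no longer involves z.\<close>
  have shift: "a m * theta_term z q (n + int m) =
        theta_term z q n * ((-1) ^ m * q ^ (m choose 2) * (q powi (n + 1)) ^ m / qpoch q m)" for m n
    unfolding a_def theta_term_add_nat[OF q(2) z0] using q(2) z0
    by (simp add: power_int_add power_mult_distrib power_divide)
  have "((\<lambda>(m, n). a m * theta_term z q n) has_sum (1 / qpinf (q / z) q * T)) (UNIV \<times> UNIV)"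
    by (rule has_sum_Times_mult[OF a T])
  hence "((\<lambda>(n, m). a m * theta_term z q (n + int m)) has_sum (1 / qpinf (q / z) q * T)) (UNIV \<times> UNIV)"
    by (subst has_sum_reindex_bij_witness[where j = "\<lambda>(n, m). (m, n + int m)"
          and i = "\<lambda>(m, n). (n - int m, m)" and T = "UNIV \<times> UNIV"
          and h = "\<lambda>(m, n). a m * theta_term z q n", OF _ _ _ _ _ refl]) auto
  hence "((\<lambda>n. theta_term z q n * qpinf (q powi (n + 1)) q) has_sum (1 / qpinf (q / z) q * T)) UNIV"
  proof (rule has_sum_SigmaD)
    show "((\<lambda>m. case (n, m) of (n, m) \<Rightarrow> a m * theta_term z q (n + int m)) has_sum
            theta_term z q n * qpinf (q powi (n + 1)) q) UNIV" for n
      unfolding prod.case shift by (rule has_sum_cmult_right[OF E2])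
  qed
  also have "?this \<longleftrightarrow>
     ((\<lambda>n. theta_term z q n * qpinf (q powi (n + 1)) q) has_sum (1 / qpinf (q / z) q * T)) (range int)"
  proof (rule has_sum_cong_neutral)
    fix n :: int assume "n \<in> UNIV - range int"
    hence "n < 0" by (metis DiffD2 nonneg_int_cases not_less rangeI)
    \<comment> \<open>Since n \<le> -1, k is a natural number and the factor of index k of the
      infinite product is 0; splitting off k factors exposes it as the head of
      \<open>qpinf 1 q\<close>.\<close>
    define k where "k = nat (- (n + 1))"
    have "n + 1 = - int k" using \<open>n < 0\<close> by (simp add: k_def)
    hence "q powi (n + 1) * q ^ k = 1"
      using q(2) by (simp add: power_int_minus)
    hence "qpinf (q powi (n + 1)) q = (\<Prod>j<k. 1 - q powi (n + 1) * q ^ j) * qpinf 1 q"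
      using qpinf_split[OF q(1), of "q powi (n + 1)" k] by simp
    thus "theta_term z q n * qpinf (q powi (n + 1)) q = 0"
      using q by simp
  qed auto
  also have "\<dots> \<longleftrightarrow> ((\<lambda>n. theta_term z q (int n) * qpinf (q ^ Suc n) q)
                      has_sum (1 / qpinf (q / z) q * T)) UNIV"
    by (subst has_sum_reindex) (simp_all add: o_def power_int_add q mult.commute)
  \<comment> \<open>For n \<ge> 0 the tail \<open>qpinf (q ^ Suc n) q\<close> equals
    \<open>qpinf q q / qpoch q n\<close>, so what remains is Euler's series for
    \<open>qpinf z q\<close>.\<close>
  also have "(\<lambda>n. theta_term z q (int n) * qpinf (q ^ Suc n) q) =
             (\<lambda>n. (-1) ^ n * q ^ (n choose 2) * z ^ n / qpoch q n * qpinf q q)"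
  proof
    fix n
    show "theta_term z q (int n) * qpinf (q ^ Suc n) q =
          (-1) ^ n * q ^ (n choose 2) * z ^ n / qpoch q n * qpinf q q"
      using qpinf_eq_qpoch[OF q(1), of n] qpoch_nonzero[OF q(1), of n] by (simp add: theta_term_nat)
  qed
  finally have "1 / qpinf (q / z) q * T = qpinf z q * qpinf q q"
    using has_sum_cmult_left[OF E2[of z], of "qpinf q q"] has_sum_unique by blast
  hence "T = qpinf z q * qpinf (q / z) q * qpinf q q"
    using qpinf_nonzero[OF q(1) qz] by (simp add: field_simps)
  thus ?thesis using T by simp
qed

section \<open>Dissections modulo 5\<close>

text \<open>The triple product in base q^5 at argument q^2 or q^3; \<open>theta5_B\<close> is the
  one at q or q^4. Divided by (q;q) they are the two Rogers-Ramanujan products.\<close>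

definition theta5_A :: "complex \<Rightarrow> complex" where
  "theta5_A q = qpinf (q ^ 2) (q ^ 5) * qpinf (q ^ 3) (q ^ 5) * qpinf (q ^ 5) (q ^ 5)"

definition theta5_B :: "complex \<Rightarrow> complex" where
  "theta5_B q = qpinf q (q ^ 5) * qpinf (q ^ 4) (q ^ 5) * qpinf (q ^ 5) (q ^ 5)"

text \<open>With r = j - 2, splitting 25k(k-1) off (5k+r)(5k+r-1) leaves r(r-1) and the linear term
  10k(r+2) = 10kj, whence the argument q^(5j). Also \<zeta>^(5k) = 1 and (-1)^(5k) = (-1)^k.\<close>

lemma theta_term_mod5:
  assumes "q \<noteq> 0" "\<zeta> ^ 5 = 1"
  shows "theta_term \<zeta> q (5 * k + (int j - 2)) =
           theta_term \<zeta> q (int j - 2) * theta_term (q ^ (5 * j)) (q ^ 25) k"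
proof -
  define r where "r = int j - 2"
  have z0: "\<zeta> \<noteq> 0" using assms by auto
  have "(5 * k + r) * (5 * k + r - 1) = r * (r - 1) + 2 * (5 * k * int j) + 25 * (k * (k - 1))"
    by (simp add: algebra_simps r_def)
  moreover have "2 dvd r * (r - 1)" "2 dvd k * (k - 1)"
    by auto
  then obtain u w where "r * (r - 1) = 2 * u" "k * (k - 1) = 2 * w"
    by (elim dvdE)
  ultimately have "(5 * k + r) * (5 * k + r - 1) div 2 =
       r * (r - 1) div 2 + 5 * k * int j + 25 * (k * (k - 1) div 2)"
    by simp
  moreover have "(q ^ n) powi m = q powi (int n * m)" for n m
    unfolding power_int_mult by simp
  ultimately have "q powi ((5 * k + r) * (5 * k + r - 1) div 2) =
      q powi (r * (r - 1) div 2) * (q ^ (5 * j)) powi k * (q ^ 25) powi (k * (k - 1) div 2)"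
    using assms by (simp add: power_int_add mult_ac)
  moreover have "\<zeta> powi (5 * k + r) = \<zeta> powi r"
    using z0 assms(2) by (simp add: power_int_add power_int_mult)
  moreover have "(-1) powi (5 * k + r) = ((-1) powi k * (-1) powi r :: complex)"
    by (simp add: power_int_add power_int_mult)
  ultimately show ?thesis
    unfolding theta_term_def r_def[symmetric] by simp
qed

lemma norm_root5:
  fixes \<zeta> :: complex
  assumes "\<zeta> ^ 5 = 1"
  shows "norm \<zeta> = 1"
proof -
  have "norm \<zeta> ^ 5 = 1" using assms by (metis norm_one norm_power)
  thus ?thesis by (intro power_eq_imp_eq_base[of "norm \<zeta>" 5 1]) auto
qed

text \<open>The residue classes -2, ..., 2 are used instead of 0, ..., 4 so that every series stays
  inside the domain of the triple product; the class -2 contributes 0.\<close>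

lemma theta_5_dissection:
  assumes q: "norm q < 1" "q \<noteq> 0" and \<zeta>: "\<zeta> ^ 5 = 1"
  shows "qpinf \<zeta> q * qpinf (q / \<zeta>) q * qpinf q q =
           (1 - \<zeta>) * theta5_A (q ^ 5) + q * (\<zeta> ^ 2 - \<zeta> ^ 4) * theta5_B (q ^ 5)"
proof -
  have z0: "\<zeta> \<noteq> 0" using \<zeta> by auto
  have nz: "norm \<zeta> = 1" by (rule norm_root5[OF \<zeta>])
  define J where "J j = qpinf (q ^ (5 * j)) (q ^ 25) * qpinf (q ^ 25 / q ^ (5 * j)) (q ^ 25)
                          * qpinf (q ^ 25) (q ^ 25)" for j
  have sums: "(theta_term \<zeta> q has_sum (theta_term \<zeta> q (int j - 2) * J j)) (range (\<lambda>k. 5 * k + (int j - 2)))"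
    if "j < 5" for j
  proof -
    \<comment> \<open>This is the condition of the triple product at argument q^(5j) in base q^25,
      and it requires j < 5.\<close>
    have "norm q ^ 25 < norm q ^ (5 * j)"
      by (rule power_strict_decreasing) (use that q in auto)
    hence "(theta_term (q ^ (5 * j)) (q ^ 25) has_sum J j) UNIV"
      unfolding J_def
      by (intro jacobi_triple_product power_less_one_norm q) (use q in \<open>auto simp: norm_power\<close>)
    thus ?thesis
      by (subst has_sum_reindex)
         (auto simp: inj_def o_def theta_term_mod5[OF q(2) \<zeta>] intro!: has_sum_cmult_right)
  qed
  have "(theta_term \<zeta> q has_sum (\<Sum>j<5. theta_term \<zeta> q (int j - 2) * J j))
          (\<Union>j\<in>{..<5}. range (\<lambda>k. 5 * k + (int j - 2)))"
  proof (rule sum_has_sum)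
    show "range (\<lambda>k. 5 * k + (int j - 2)) \<inter> range (\<lambda>k. 5 * k + (int j' - 2)) = {}"
      if "j \<in> {..<5}" "j' \<in> {..<5}" "j \<noteq> j'" for j j' :: nat
      using that by auto presburger
  qed (use sums in auto)
  also have "(\<Union>j\<in>{..<5::nat}. range (\<lambda>k. 5 * k + (int j - 2))) = UNIV"
  proof -
    have "n \<in> range (\<lambda>k. 5 * k + (int (nat ((n + 2) mod 5)) - 2))" for n
    proof (rule range_eqI[of _ _ "(n + 2) div 5"])
      have "int (nat ((n + 2) mod 5)) = (n + 2) mod 5" by simp
      thus "n = 5 * ((n + 2) div 5) + (int (nat ((n + 2) mod 5)) - 2)"
        using mult_div_mod_eq[of 5 "n + 2"] by linarith
    qed
    moreover have "nat ((n + 2) mod 5) < 5" for n :: int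
      by (simp add: nat_less_iff)
    ultimately show ?thesis by blast
  qed
  finally have "(\<Sum>j<5. theta_term \<zeta> q (int j - 2) * J j) = qpinf \<zeta> q * qpinf (q / \<zeta>) q * qpinf q q"
    using jacobi_triple_product[OF q, of \<zeta>] nz q has_sum_unique by metis
  moreover have "J 0 = 0"
    using power_less_one_norm[OF q(1), of 25] by (simp add: J_def)
  moreover have "J 1 = theta5_B (q ^ 5)" "J 2 = theta5_A (q ^ 5)"
                "J 3 = theta5_A (q ^ 5)" "J 4 = theta5_B (q ^ 5)"
    using q(2) by (simp_all add: J_def theta5_A_def theta5_B_def flip: power_mult power_diff)
  \<comment> \<open>The exponent r(r-1)/2 is 1 for r = -1, 2 and 0 for r = 0, 1. These are also the
    pairs sharing a theta product, as j and 5 - j give the same one.\<close>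
  moreover have "theta_term \<zeta> q (-1) = - (\<zeta> ^ 4 * q)" "theta_term \<zeta> q 0 = 1"
    "theta_term \<zeta> q 1 = - \<zeta>" "theta_term \<zeta> q 2 = \<zeta> ^ 2 * q"
    using z0 \<zeta> by (simp_all add: theta_term_def power_int_minus field_simps eval_nat_numeral)
  ultimately show ?thesis
    by (simp add: lessThan_nat_numeral lessThan_Suc algebra_simps)
qed

text \<open>Both sides of the dissection contain the factor 1 - \<zeta>: it is the head of
  \<open>qpinf \<zeta> q\<close>, and \<zeta>^2 - \<zeta>^4 = (1 - \<zeta>)(\<zeta>^2 +
  \<zeta>^3).\<close>

lemma theta_5_dissection_normalized:
  assumes q: "norm q < 1" "q \<noteq> 0" and \<zeta>: "\<zeta> ^ 5 = 1" "\<zeta> \<noteq> 1"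
  shows "qpinf (\<zeta> * q) q * qpinf (q / \<zeta>) q * qpinf q q =
           theta5_A (q ^ 5) + q * (\<zeta> ^ 2 + \<zeta> ^ 3) * theta5_B (q ^ 5)"
proof -
  have "(1 - \<zeta>) * (qpinf (\<zeta> * q) q * qpinf (q / \<zeta>) q * qpinf q q) =
        (1 - \<zeta>) * (theta5_A (q ^ 5) + q * (\<zeta> ^ 2 + \<zeta> ^ 3) * theta5_B (q ^ 5))"
    using theta_5_dissection[OF q \<zeta>(1)]
    by (simp add: qpinf_Suc[OF q(1), of \<zeta>] algebra_simps eval_nat_numeral)
  thus ?thesis using \<zeta>(2) by simp
qed

section \<open>Gaussian periods and products over the fifth roots of unity\<close>

lemma root5_sums:
  fixes \<zeta> :: complex
  assumes "\<zeta> ^ 5 = 1" "\<zeta> \<noteq> 1"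
  shows "(\<zeta> + \<zeta> ^ 4) + (\<zeta> ^ 2 + \<zeta> ^ 3) = -1" "(\<zeta> + \<zeta> ^ 4) * (\<zeta> ^ 2 + \<zeta> ^ 3) = -1"
proof -
  have "(1 - \<zeta>) * (1 + \<zeta> + \<zeta> ^ 2 + \<zeta> ^ 3 + \<zeta> ^ 4) = 0"
    using assms(1) by (simp add: algebra_simps eval_nat_numeral)
  hence *: "1 + \<zeta> + \<zeta> ^ 2 + \<zeta> ^ 3 + \<zeta> ^ 4 = 0"
    using assms(2) by simp
  thus **: "(\<zeta> + \<zeta> ^ 4) + (\<zeta> ^ 2 + \<zeta> ^ 3) = -1"
    by (simp add: add_eq_0_iff algebra_simps)
  have "(\<zeta> + \<zeta> ^ 4) * (\<zeta> ^ 2 + \<zeta> ^ 3) = \<zeta> ^ 3 + \<zeta> ^ 4 + \<zeta> ^ 5 * \<zeta> + \<zeta> ^ 5 * \<zeta> ^ 2"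
    by (simp add: algebra_simps eval_nat_numeral)
  also have "\<dots> = (\<zeta> + \<zeta> ^ 4) + (\<zeta> ^ 2 + \<zeta> ^ 3)"
    using assms(1) by simp
  finally show "(\<zeta> + \<zeta> ^ 4) * (\<zeta> ^ 2 + \<zeta> ^ 3) = -1"
    using ** by simp
qed

text \<open>Pairing j with 5 - j gives 1 - ax + x^2 and 1 - bx + x^2 with the periods a and b, and
  their product involves only a + b and ab.\<close>

lemma prod_root5:
  fixes \<zeta> x :: complex
  assumes "\<zeta> ^ 5 = 1" "\<zeta> \<noteq> 1"
  shows "(\<Prod>j<5. 1 - \<zeta> ^ j * x) = 1 - x ^ 5"
proof -
  define a b where "a = \<zeta> + \<zeta> ^ 4" "b = \<zeta> ^ 2 + \<zeta> ^ 3"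
  have ab: "a + b = -1" "a * b = -1"
    using root5_sums[OF assms] by (simp_all add: a_b_def)
  have "(1 - \<zeta> * x) * (1 - \<zeta> ^ 4 * x) = 1 - a * x + \<zeta> ^ 5 * x ^ 2"
       "(1 - \<zeta> ^ 2 * x) * (1 - \<zeta> ^ 3 * x) = 1 - b * x + \<zeta> ^ 5 * x ^ 2"
    by (simp_all add: a_b_def algebra_simps eval_nat_numeral)
  moreover have "(\<Prod>j<5. 1 - \<zeta> ^ j * x) = (1 - x) * (((1 - \<zeta> * x) * (1 - \<zeta> ^ 4 * x)) *
                   ((1 - \<zeta> ^ 2 * x) * (1 - \<zeta> ^ 3 * x)))"
    by (simp add: lessThan_nat_numeral lessThan_Suc mult_ac)
  ultimately have "(\<Prod>j<5. 1 - \<zeta> ^ j * x) = (1 - x) * ((1 - a * x + x ^ 2) * (1 - b * x + x ^ 2))"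
    using assms(1) by simp
  also have "\<dots> = (1 - x) * (1 - (a + b) * x + (2 + a * b) * x ^ 2 - (a + b) * x ^ 3 + x ^ 4)"
    by (simp add: algebra_simps eval_nat_numeral)
  also have "\<dots> = 1 - x ^ 5"
    unfolding ab by (simp add: algebra_simps eval_nat_numeral)
  finally show ?thesis .
qed

lemma prod_qpinf_root5:
  assumes "norm q < 1" "\<zeta> ^ 5 = 1" "\<zeta> \<noteq> 1"
  shows "(\<Prod>j<5. qpinf (\<zeta> ^ j * q) q) = qpinf (q ^ 5) (q ^ 5)"
proof -
  have "(\<Prod>j<5. qpinf (\<zeta> ^ j * q) q) = (\<Prod>k. \<Prod>j<5. 1 - \<zeta> ^ j * q * q ^ k)"
    unfolding qpinf_def by (rule prodinf_prod[symmetric]) (rule convergent_prod_qpinf[OF assms(1)])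
  also have "\<dots> = qpinf (q ^ 5) (q ^ 5)"
    unfolding qpinf_def
  proof (rule prodinf_cong)
    fix k
    have "(q * q ^ k) ^ 5 = q ^ 5 * (q ^ 5) ^ k"
      by (metis mult.commute power_mult power_mult_distrib)
    thus "(\<Prod>j<5. 1 - \<zeta> ^ j * q * q ^ k) = 1 - q ^ 5 * (q ^ 5) ^ k"
      using prod_root5[OF assms(2,3), of "q * q ^ k"] by (simp only: mult.assoc)
  qed
  finally show ?thesis .
qed

lemma root5_facts:
  fixes \<zeta> :: complex
  assumes "\<zeta> ^ 5 = 1" "\<zeta> \<noteq> 1"
  shows "(\<zeta> ^ 2) ^ 5 = 1" "\<zeta> ^ 2 \<noteq> 1" "q / \<zeta> = \<zeta> ^ 4 * q" "q / \<zeta> ^ 2 = \<zeta> ^ 3 * q"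
    "(\<zeta> ^ 2) ^ 2 + (\<zeta> ^ 2) ^ 3 = \<zeta> + \<zeta> ^ 4"
proof -
  have z0: "\<zeta> \<noteq> 0" using assms by auto
  have *: "\<zeta> * \<zeta> ^ 4 = 1" "\<zeta> ^ 2 * \<zeta> ^ 3 = 1" using assms(1) by (simp_all add: eval_nat_numeral mult_ac)
  show "(\<zeta> ^ 2) ^ 5 = 1" using assms(1) by (metis mult.commute power_mult power_one)
  show "\<zeta> ^ 2 \<noteq> 1"
  proof
    assume "\<zeta> ^ 2 = 1"
    moreover have "\<zeta> ^ 5 = \<zeta> ^ 2 * \<zeta> ^ 2 * \<zeta>" by (simp add: eval_nat_numeral)
    ultimately show False using assms by simp
  qed
  show "q / \<zeta> = \<zeta> ^ 4 * q"
    using z0 *(1) by (simp add: divide_eq_eq mult_ac)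
  show "q / \<zeta> ^ 2 = \<zeta> ^ 3 * q"
    using z0 *(2) by (simp add: divide_eq_eq mult_ac)
  have "(\<zeta> ^ 2) ^ 3 = \<zeta> ^ 5 * \<zeta>" by (simp flip: power_mult power_Suc2)
  thus "(\<zeta> ^ 2) ^ 2 + (\<zeta> ^ 2) ^ 3 = \<zeta> + \<zeta> ^ 4" using assms(1) by (simp flip: power_mult)
qed

text \<open>Because q/\<zeta> = \<zeta>^4 q and q/\<zeta>^2 = \<zeta>^3 q, all nontrivial fifth
  roots occur once. One of the two copies of \<open>qpinf q q\<close> supplies j = 0, the other is
  left over.\<close>

lemma theta_5_product:
  assumes q: "norm q < 1" and \<zeta>: "\<zeta> ^ 5 = 1" "\<zeta> \<noteq> 1"
  shows "(qpinf (\<zeta> * q) q * qpinf (q / \<zeta>) q * qpinf q q) *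
         (qpinf (\<zeta> ^ 2 * q) q * qpinf (q / \<zeta> ^ 2) q * qpinf q q) =
         qpinf q q * qpinf (q ^ 5) (q ^ 5)"
proof -
  have "(\<Prod>j<5. qpinf (\<zeta> ^ j * q) q) =
        qpinf q q * qpinf (\<zeta> * q) q * qpinf (\<zeta> ^ 2 * q) q * qpinf (\<zeta> ^ 3 * q) q * qpinf (\<zeta> ^ 4 * q) q"
    by (simp add: lessThan_nat_numeral lessThan_Suc)
  thus ?thesis
    unfolding root5_facts(3,4)[OF \<zeta>] prod_qpinf_root5[OF q \<zeta>] by (simp only: mult_ac)
qed

text \<open>Multiplying the dissections at two inequivalent fifth roots of unity yields the 5-dissection of
  (q;q), without recourse to the quintuple product identity.\<close>

lemma qpinf_5_dissection:
  assumes q: "norm q < 1" "q \<noteq> 0" and \<zeta>: "\<zeta> ^ 5 = 1" "\<zeta> \<noteq> (1 :: complex)"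
  shows "qpinf q q * qpinf (q ^ 5) (q ^ 5) =
     theta5_A (q ^ 5) ^ 2 - q * theta5_A (q ^ 5) * theta5_B (q ^ 5) - q ^ 2 * theta5_B (q ^ 5) ^ 2"
proof -
  note r = root5_facts[OF \<zeta>]
  define a b where "a = \<zeta> + \<zeta> ^ 4" "b = \<zeta> ^ 2 + \<zeta> ^ 3"
  have ab: "a + b = -1" "a * b = -1"
    using root5_sums[OF \<zeta>] by (simp_all add: a_b_def)
  have "qpinf q q * qpinf (q ^ 5) (q ^ 5) =
        (theta5_A (q ^ 5) + q * b * theta5_B (q ^ 5)) * (theta5_A (q ^ 5) + q * a * theta5_B (q ^ 5))"
    using theta_5_product[OF q(1) \<zeta>] unfolding theta_5_dissection_normalized[OF q \<zeta>]
      theta_5_dissection_normalized[OF q r(1,2)] r(5) a_b_def by simp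
  also have "\<dots> = theta5_A (q ^ 5) ^ 2 + q * (a + b) * theta5_A (q ^ 5) * theta5_B (q ^ 5)
                 + q ^ 2 * (a * b) * theta5_B (q ^ 5) ^ 2"
    by (simp add: algebra_simps power2_eq_square)
  finally show ?thesis unfolding ab by simp
qed

text \<open>The algebra of the final product with the theta factors abstracted: u, v, e stand for
  the factors in base q^50 with v e and u e the values of A and B there, and s, t, f for those in
  base q^25. Dividing each dissection separately by its product (u v e or s t f) cancels f and
  leaves a single e.\<close>

lemma expand_dissection_product:
  fixes u v s t e f q c :: complex
  assumes "u \<noteq> 0" "v \<noteq> 0" "s \<noteq> 0" "t \<noteq> 0" "e \<noteq> 0" "f \<noteq> 0"
  shows "((v * e) ^ 2 - q ^ 2 * (v * e) * (u * e) - q ^ 4 * (u * e) ^ 2) * (t * f + q * c * (s * f))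
           / (u * v * e * (s * t * f)) =
         v * e / (s * u) - q ^ 5 * c * (u * e / (t * v)) + q * (c * (v * e / (t * u)))
         + q ^ 2 * (- (e / s)) + q ^ 3 * (- c * (e / t)) + q ^ 4 * (- (u * e / (s * v)))"
proof -
  have "(v * e) ^ 2 - q ^ 2 * (v * e) * (u * e) - q ^ 4 * (u * e) ^ 2 =
        (v / u - q ^ 2 - q ^ 4 * (u / v)) * e * (u * v * e)"
    using assms by (simp add: field_simps power2_eq_square)
  moreover have "t * f + q * c * (s * f) = (1 / s + q * c * (1 / t)) * (s * t * f)"
    using assms by (simp add: field_simps)
  ultimately have "((v * e) ^ 2 - q ^ 2 * (v * e) * (u * e) - q ^ 4 * (u * e) ^ 2) * (t * f + q * c * (s * f))
           / (u * v * e * (s * t * f)) = (v / u - q ^ 2 - q ^ 4 * (u / v)) * e * (1 / s + q * c * (1 / t))"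
    using assms by simp
  also have "\<dots> = v * e / (s * u) - q ^ 5 * c * (u * e / (t * v)) + q * (c * (v * e / (t * u)))
         + q ^ 2 * (- (e / s)) + q ^ 3 * (- c * (e / t)) + q ^ 4 * (- (u * e / (s * v)))"
    by (simp add: algebra_simps add_divide_distrib diff_divide_distrib eval_nat_numeral)
  finally show ?thesis .
qed

lemma Mbar_gf_5_dissection:
  assumes q: "norm q < 1" and \<zeta>: "\<zeta> ^ 5 = 1" "\<zeta> \<noteq> 1"
  shows "Mbar_gf \<zeta> q = Mbar05 \<zeta> (q^5) + q * Mbar15 \<zeta> (q^5) + q^2 * Mbar25 \<zeta> (q^5)
            + q^3 * Mbar35 \<zeta> (q^5) + q^4 * Mbar45 \<zeta> (q^5)"
\<comment> \<open>The triple product excludes q = 0, where both sides are 1.\<close>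
proof (cases "q = 0")
  case True
  thus ?thesis by (simp add: Mbar_gf_def Mbar05_def)
next
  case False
  note r = root5_facts[OF \<zeta>]
  define Q c where "Q = q ^ 5" "c = \<zeta> + \<zeta> ^ 4"
  have Q: "norm Q < 1" using power_less_one_norm[OF q] by (simp add: Q_c_def)
  define a d where "a i = qpinf (Q ^ i) (Q ^ 5)" and "d i = qpinf (Q ^ i) (Q ^ 10)" for i
  have nz: "a i \<noteq> 0" "d i \<noteq> 0" if "i > 0" for i
    unfolding a_def d_def by (intro qpinf_nonzero power_less_one_norm Q; use that in simp)+
  have "qpinf Q Q = (\<Prod>r<5. a (Suc r))"
    using qpinf_multisect[OF Q, of 5 Q] by (simp add: a_def)
  hence PQ: "qpinf Q Q = a 1 * a 2 * a 3 * a 4 * a 5"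
    by (simp add: eval_nat_numeral lessThan_Suc mult_ac)
  have "qpinf (Q ^ 2) (Q ^ 2) = (\<Prod>r<5. d (2 * Suc r))"
  proof -
    have "Q ^ 2 * (Q ^ 2) ^ r = Q ^ (2 * Suc r)" for r
      unfolding power_mult by simp
    moreover have "(Q ^ 2) ^ 5 = Q ^ 10"
      by (simp flip: power_mult)
    ultimately show ?thesis
      using qpinf_multisect[OF power_less_one_norm[OF Q], of 2 5 "Q ^ 2"] by (simp add: d_def)
  qed
  hence PQ2: "qpinf (Q ^ 2) (Q ^ 2) = d 2 * d 4 * d 6 * d 8 * d 10"
    by (simp add: eval_nat_numeral lessThan_Suc mult_ac)
  have AB: "theta5_A Q = a 2 * a 3 * a 5" "theta5_B Q = a 1 * a 4 * a 5"
           "theta5_A (Q ^ 2) = d 4 * d 6 * d 10" "theta5_B (Q ^ 2) = d 2 * d 8 * d 10"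
    by (simp_all add: theta5_A_def theta5_B_def a_def d_def flip: power_mult)
  have "norm (q ^ 2) < 1" "q ^ 2 \<noteq> 0" using False q by (auto intro: power_less_one_norm)
  from qpinf_5_dissection[OF this \<zeta>]
  have E: "qpinf (q ^ 2) (q ^ 2) * qpinf (Q ^ 2) (Q ^ 2) =
      theta5_A (Q ^ 2) ^ 2 - q ^ 2 * theta5_A (Q ^ 2) * theta5_B (Q ^ 2) - q ^ 4 * theta5_B (Q ^ 2) ^ 2"
    by (simp add: Q_c_def flip: power_mult)
  define X where "X = qpinf (\<zeta> * q) q * qpinf (q / \<zeta>) q"
  \<comment> \<open>The cofactor is the dissection at \<zeta>^2, whose period is c = \<zeta> +
    \<zeta>^4, the one in the statement.\<close>
  have "X * qpinf q q * (theta5_A Q + q * c * theta5_B Q) = qpinf q q * qpinf Q Q"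
    using theta_5_product[OF q \<zeta>] theta_5_dissection_normalized[OF q False r(1,2)]
    unfolding X_def Q_c_def r(5) by simp
  hence X: "X * (theta5_A Q + q * c * theta5_B Q) = qpinf Q Q"
    using qpinf_nonzero[OF q q] by simp
  have "Mbar_gf \<zeta> q = qpinf (q ^ 2) (q ^ 2) / X"
    using qpinf_minus_mult[OF q, of q] by (simp add: Mbar_gf_def X_def)
  also have "\<dots> = (qpinf (q ^ 2) (q ^ 2) * qpinf (Q ^ 2) (Q ^ 2)) * (theta5_A Q + q * c * theta5_B Q)
                   / (qpinf (Q ^ 2) (Q ^ 2) * qpinf Q Q)"
  proof -
    have "qpinf (Q ^ 2) (Q ^ 2) \<noteq> 0" "qpinf Q Q \<noteq> 0"
      unfolding PQ PQ2 by (simp_all add: nz)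
    thus ?thesis unfolding X[symmetric] by simp
  qed
  also have "\<dots> = Mbar05 \<zeta> Q + q * Mbar15 \<zeta> Q + q^2 * Mbar25 \<zeta> Q
            + q^3 * Mbar35 \<zeta> Q + q^4 * Mbar45 \<zeta> Q"
  proof -
    have Q1: "qpinf Q (Q ^ 5) = a 1" by (simp add: a_def)
    have q5: "q ^ 5 = Q" by (simp add: Q_c_def)
    have "((d 4 * d 6 * d 10) ^ 2 - q ^ 2 * (d 4 * d 6 * d 10) * (d 2 * d 8 * d 10)
             - q ^ 4 * (d 2 * d 8 * d 10) ^ 2) * (a 2 * a 3 * a 5 + q * c * (a 1 * a 4 * a 5))
          / (d 2 * d 4 * d 6 * d 8 * d 10 * (a 1 * a 2 * a 3 * a 4 * a 5)) =
         d 4 * d 6 * d 10 / (a 1 * a 4 * d 2 * d 8) - Q * c * (d 2 * d 8 * d 10 / (a 2 * a 3 * d 4 * d 6))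
         + q * (c * (d 4 * d 6 * d 10 / (a 2 * a 3 * d 2 * d 8)))
         + q ^ 2 * (- (d 10 / (a 1 * a 4))) + q ^ 3 * (- c * (d 10 / (a 2 * a 3)))
         + q ^ 4 * (- (d 2 * d 8 * d 10 / (a 1 * a 4 * d 4 * d 6)))"
      unfolding Q_c_def(1)
      using expand_dissection_product[of "d 2 * d 8" "d 4 * d 6" "a 1 * a 4" "a 2 * a 3" "d 10" "a 5" q c]
        nz[of 1] nz[of 2] nz[of 3] nz[of 4] nz[of 5] nz[of 6] nz[of 8] nz[of 10]
      by (simp add: mult_ac)
    thus ?thesis
      unfolding E unfolding AB PQ PQ2 Mbar05_def Mbar15_def Mbar25_def Mbar35_def Mbar45_def
      unfolding Q1 a_def[symmetric] d_def[symmetric] Q_c_def(2)[symmetric]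
      by simp
  qed
  finally show ?thesis by (simp add: Q_c_def)
qed

section \<open>The coefficients of the generating function\<close>

text \<open>The number of partitions of n into parts of size at most m, the coefficient of q^n in
  \<open>1 / qpoch q m\<close>. In the recursion i is the total contributed by parts equal to
  \<open>Suc m\<close>.\<close>

primrec qpoch_coeff :: "nat \<Rightarrow> nat \<Rightarrow> nat" where
  "qpoch_coeff 0 n = (if n = 0 then 1 else 0)"
| "qpoch_coeff (Suc m) n = (\<Sum>i\<le>n. if Suc m dvd i then qpoch_coeff m (n - i) else 0)"

lemma qpoch_coeff_sums:
  assumes "norm q < 1"
  shows "(\<lambda>n. of_nat (qpoch_coeff m n) * q ^ n) sums (1 / qpoch q m)"
    and "summable (\<lambda>n. norm (of_nat (qpoch_coeff m n) * q ^ n))"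
proof -
  have "(\<lambda>n. of_nat (qpoch_coeff m n) * q ^ n) sums (1 / qpoch q m) \<and>
        summable (\<lambda>n. norm (of_nat (qpoch_coeff m n) * q ^ n))"
    if "norm q < 1" for q
    using that
  proof (induction m arbitrary: q)
    case 0
    have "(\<lambda>n. of_nat (qpoch_coeff 0 n) * q ^ n) = (\<lambda>n. if n = 0 then 1 else 0)" for q :: complex
      by auto
    moreover have "(\<lambda>n. norm (of_nat (qpoch_coeff 0 n) * q ^ n)) = (\<lambda>n. if n = 0 then 1 else 0)"
      by auto
    moreover have "(\<lambda>n. if n = 0 then 1 else 0 :: complex) sums 1"
      using sums_single[of 0 "\<lambda>_. 1 :: complex"] by simp
    moreover have "summable (\<lambda>n. if n = 0 then 1 else 0 :: real)"
      using sums_single[of 0 "\<lambda>_. 1 :: real"] by (simp add: sums_iff)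
    ultimately show ?case by simp
  next
    case (Suc m)
    have step: "(\<lambda>n. of_nat (qpoch_coeff (Suc m) n) * q ^ n) sums (1 / qpoch q (Suc m))"
      if q: "norm q < 1" for q
    proof -
      define g where "g i = (if Suc m dvd i then q ^ i else 0)" for i
      have nq: "norm (q ^ Suc m) < 1"
        using power_less_one_norm[OF q] by blast
      have sm: "strict_mono (\<lambda>j. Suc m * j)"
        by (intro strict_monoI mult_strict_left_mono) auto
      have "(\<lambda>j. g (Suc m * j)) sums (1 / (1 - q ^ Suc m))"
        using geometric_sums[OF nq] by (simp add: g_def power_mult del: power_Suc mult_Suc)
      hence g: "g sums (1 / (1 - q ^ Suc m))"
        by (subst (asm) sums_mono_reindex[OF sm]) (auto simp: g_def elim!: dvdE)
      have "summable (\<lambda>j. norm (g (Suc m * j)))"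
        using nq by (simp add: g_def power_mult norm_power del: power_Suc mult_Suc)
      hence g': "summable (\<lambda>j. norm (g j))"
        by (subst (asm) summable_mono_reindex[OF sm, of "\<lambda>j. norm (g j)"]) (auto simp: g_def elim!: dvdE)
      have "(\<lambda>n. \<Sum>i\<le>n. g i * (of_nat (qpoch_coeff m (n - i)) * q ^ (n - i))) sums
              ((\<Sum>n. g n) * (\<Sum>n. of_nat (qpoch_coeff m n) * q ^ n))"
        using Suc.IH[OF q] by (intro Cauchy_product_sums g') auto
      also have "(\<lambda>n. \<Sum>i\<le>n. g i * (of_nat (qpoch_coeff m (n - i)) * q ^ (n - i))) =
                 (\<lambda>n. of_nat (qpoch_coeff (Suc m) n) * q ^ n)"
      proof
        fix n
        have "g i * (of_nat (qpoch_coeff m (n - i)) * q ^ (n - i)) =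
              of_nat (if Suc m dvd i then qpoch_coeff m (n - i) else 0) * q ^ n" if "i \<le> n" for i
          using that by (simp add: g_def flip: power_add)
        thus "(\<Sum>i\<le>n. g i * (of_nat (qpoch_coeff m (n - i)) * q ^ (n - i))) =
              of_nat (qpoch_coeff (Suc m) n) * q ^ n"
          by (simp add: sum_distrib_right)
      qed
      also have "(\<Sum>n. g n) * (\<Sum>n. of_nat (qpoch_coeff m n) * q ^ n) = 1 / qpoch q (Suc m)"
        using Suc.IH[OF q] g by (simp add: sums_iff qpoch_Suc)
      finally show ?thesis .
    qed
    \<comment> \<open>The coefficients are nonnegative, so absolute convergence at q is convergence
      at |q|; hence \<open>step\<close> is proved for every q.\<close>
    have "summable (\<lambda>n. of_nat (qpoch_coeff (Suc m) n) * complex_of_real (norm q) ^ n)"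
      using step[of "of_real (norm q)"] Suc.prems by (auto simp: sums_iff)
    also have "(\<lambda>n. of_nat (qpoch_coeff (Suc m) n) * complex_of_real (norm q) ^ n) =
               (\<lambda>n. complex_of_real (norm (of_nat (qpoch_coeff (Suc m) n) * q ^ n)))"
      by (simp add: norm_mult norm_power del: qpoch_coeff.simps)
    finally show ?case
      using step[OF Suc.prems] by (simp only: summable_complex_of_real simp_thms)
  qed
  thus "(\<lambda>n. of_nat (qpoch_coeff m n) * q ^ n) sums (1 / qpoch q m)"
    and "summable (\<lambda>n. norm (of_nat (qpoch_coeff m n) * q ^ n))"
    using assms by auto
qed

text \<open>Absolute summability of the double family: the norms of row m add up to
  \<open>norm (w m)\<close> times the value at |q| of the reciprocal of \<open>qpoch\<close>, and
  these values are bounded in m.\<close>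

lemma has_sum_expand_qpoch:
  assumes q: "norm q < 1" and w: "summable (\<lambda>m. norm (w m))"
    and S: "((\<lambda>m. w m / qpoch q m) has_sum S) UNIV"
  shows "((\<lambda>(m, n). w m * (of_nat (qpoch_coeff m n) * q ^ n)) has_sum S) (UNIV \<times> UNIV)"
proof (rule has_sum_SigmaI)
  show "((\<lambda>n. case (m, n) of (m, n) \<Rightarrow> w m * (of_nat (qpoch_coeff m n) * q ^ n))
           has_sum w m / qpoch q m) UNIV" for m
    using has_sum_cmult_right[OF norm_summable_imp_has_sum[OF qpoch_coeff_sums(2,1)[OF q]], of "w m" m]
    by simp
  show "((\<lambda>m. w m / qpoch q m) has_sum S) UNIV"
    by fact
  define Q where "Q = complex_of_real (norm q)"
  have Q: "norm Q < 1" using q by (simp add: Q_def)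
  obtain C where C: "C > 0" "\<And>m. norm (1 / qpoch Q m) \<le> C"
    using qpoch_inverse_bounded[OF Q] by blast
  have inner: "((\<lambda>n. norm (of_nat (qpoch_coeff m n) * q ^ n)) has_sum norm (1 / qpoch Q m)) UNIV" for m
  proof -
    have "(\<lambda>n. complex_of_real (norm (of_nat (qpoch_coeff m n) * q ^ n))) sums (1 / qpoch Q m)"
      using qpoch_coeff_sums(1)[OF Q, of m] by (simp add: Q_def norm_mult norm_power)
    moreover have "summable (\<lambda>n. norm (of_nat (qpoch_coeff m n) * q ^ n))"
      by (rule qpoch_coeff_sums(2)[OF q])
    ultimately have "1 / qpoch Q m = complex_of_real (\<Sum>n. norm (of_nat (qpoch_coeff m n) * q ^ n))"
      using sums_of_real[OF summable_sums] sums_unique2 by blast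
    moreover have "(\<Sum>n. norm (of_nat (qpoch_coeff m n) * q ^ n)) \<ge> 0"
      by (intro suminf_nonneg qpoch_coeff_sums(2)[OF q]) auto
    ultimately have "norm (1 / qpoch Q m) = (\<Sum>n. norm (of_nat (qpoch_coeff m n) * q ^ n))"
      by (metis abs_of_nonneg norm_of_real)
    thus ?thesis
      using sums_nonneg_imp_has_sum[OF summable_sums[OF qpoch_coeff_sums(2)[OF q, of m]]] by simp
  qed
  have inner': "((\<lambda>n. norm (w m * (of_nat (qpoch_coeff m n) * q ^ n))) has_sum
                   (norm (w m) * norm (1 / qpoch Q m))) UNIV" for m
    unfolding norm_mult[of "w m"] by (intro has_sum_cmult_right inner)
  have "(\<lambda>p. norm (case p of (m, n) \<Rightarrow> w m * (of_nat (qpoch_coeff m n) * q ^ n))) summable_on (UNIV \<times> UNIV)"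
    unfolding Infinite_Sum.abs_summable_on_Sigma_iff
  proof (intro conjI ballI)
    show "(\<lambda>n. norm (case (m, n) of (m, n) \<Rightarrow> w m * (of_nat (qpoch_coeff m n) * q ^ n))) summable_on UNIV" for m
      using inner'[of m] has_sum_imp_summable by simp
    have "summable (\<lambda>m. norm (norm (w m) * norm (1 / qpoch Q m)))"
    proof (rule summable_comparison_test')
      show "summable (\<lambda>m. norm (w m) * C)"
        by (intro summable_mult2 w)
      show "norm (norm (norm (w m) * norm (1 / qpoch Q m))) \<le> norm (w m) * C" for m
        using C(2)[of m] by (auto simp: abs_mult intro!: mult_left_mono)
    qed
    hence "(\<lambda>m. norm (w m) * norm (1 / qpoch Q m)) summable_on UNIV"
      by (rule norm_summable_imp_summable_on)
    thus "(\<lambda>m. norm (\<Sum>\<^sub>\<infinity>n. norm (case (m, n) of (m, n) \<Rightarrow> w m * (of_nat (qpoch_coeff m n) * q ^ n))))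
            summable_on UNIV"
      using infsumI[OF inner'] by simp
  qed
  thus "(\<lambda>(m, n). w m * (of_nat (qpoch_coeff m n) * q ^ n)) summable_on (UNIV \<times> UNIV)"
    by (rule abs_summable_summable)
qed

definition convergence_domain :: "complex \<Rightarrow> complex \<Rightarrow> bool" where
  "convergence_domain z q \<longleftrightarrow> norm q < 1 \<and> norm q < norm z \<and> norm z * norm q < 1"

text \<open>The numerator is \<open>qpinf (q ^ 2) (q ^ 2)\<close>, expanded by Euler's second series
  in base q^2 (indices k, l); each reciprocal is expanded by the first series. The domain says
  exactly that q, zq and q/z have norm below 1.\<close>

lemma Mbar_gf_expansion:
  assumes "convergence_domain z q"
  shows "((\<lambda>(((m1, n1), (m2, n2)), (k, l)).
            of_int (int (qpoch_coeff m1 n1 * qpoch_coeff m2 n2 * qpoch_coeff k l) * (-1) ^ k) *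
            z powi (int m1 - int m2) *
            q ^ (m1 + n1 + m2 + n2 + 2 * (k choose 2) + 2 * k + 2 * l)) has_sum Mbar_gf z q) UNIV"
proof -
  have q: "norm q < 1" and zq: "norm (z * q) < 1" and z0: "z \<noteq> 0" and qz: "norm (q / z) < 1"
    using assms by (auto simp: convergence_domain_def norm_mult norm_divide divide_simps)
  have q2: "norm (q ^ 2) < 1" using power_less_one_norm[OF q] by simp
  have pw: "summable (\<lambda>m. norm (x ^ m))" if "norm x < 1" for x :: complex
    using that by (simp add: norm_power)
  have e1: "((\<lambda>(m, n). x ^ m * (of_nat (qpoch_coeff m n) * q ^ n)) has_sum 1 / qpinf x q) (UNIV \<times> UNIV)"
    if "norm x < 1" for x
    by (intro has_sum_expand_qpoch norm_summable_imp_has_sum euler_summable1 euler1 q that pw)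
  have s3: "summable (\<lambda>m. norm ((-1) ^ m * (q ^ 2) ^ (m choose 2) * (q ^ 2) ^ m))"
    using summable_power_choose_two[OF q2, of "q ^ 2"] by (simp add: norm_mult norm_power)
  have e3: "((\<lambda>(m, n). ((-1) ^ m * (q ^ 2) ^ (m choose 2) * (q ^ 2) ^ m) *
               (of_nat (qpoch_coeff m n) * (q ^ 2) ^ n)) has_sum qpinf (q ^ 2) (q ^ 2)) (UNIV \<times> UNIV)"
    by (intro has_sum_expand_qpoch s3 norm_summable_imp_has_sum euler_summable2 euler2 q2)
  have "1 / qpinf (z * q) q * (1 / qpinf (q / z) q) * qpinf (q ^ 2) (q ^ 2) = Mbar_gf z q"
    using qpinf_minus_mult[OF q, of q] by (simp add: Mbar_gf_def)
  with has_sum_Times_mult[OF has_sum_Times_mult[OF e1[OF zq] e1[OF qz]] e3]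
  have "((\<lambda>(x, y). (case x of (x, y) \<Rightarrow> (case x of (m, n) \<Rightarrow> (z * q) ^ m * (of_nat (qpoch_coeff m n) * q ^ n)) *
                     (case y of (m, n) \<Rightarrow> (q / z) ^ m * (of_nat (qpoch_coeff m n) * q ^ n))) *
           (case y of (m, n) \<Rightarrow> (-1) ^ m * (q ^ 2) ^ (m choose 2) * (q ^ 2) ^ m *
               (of_nat (qpoch_coeff m n) * (q ^ 2) ^ n))) has_sum Mbar_gf z q) UNIV"
    by simp
  also have "?this \<longleftrightarrow> ?thesis"
  proof (rule has_sum_cong)
    show "(case p of (x, y) \<Rightarrow> (case x of (x, y) \<Rightarrow> (case x of (m, n) \<Rightarrow> (z * q) ^ m * (of_nat (qpoch_coeff m n) * q ^ n)) *
                     (case y of (m, n) \<Rightarrow> (q / z) ^ m * (of_nat (qpoch_coeff m n) * q ^ n))) *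
           (case y of (m, n) \<Rightarrow> (-1) ^ m * (q ^ 2) ^ (m choose 2) * (q ^ 2) ^ m *
               (of_nat (qpoch_coeff m n) * (q ^ 2) ^ n))) =
          (\<lambda>(((m1, n1), (m2, n2)), (k, l)).
            of_int (int (qpoch_coeff m1 n1 * qpoch_coeff m2 n2 * qpoch_coeff k l) * (-1) ^ k) *
            z powi (int m1 - int m2) *
            q ^ (m1 + n1 + m2 + n2 + 2 * (k choose 2) + 2 * k + 2 * l)) p" for p
    proof -
      obtain m1 n1 m2 n2 k l where [simp]: "p = (((m1, n1), (m2, n2)), (k, l))"
        by (metis prod.collapse)
      show ?thesis
        using z0 by (simp add: power_int_diff power_mult_distrib power_divide power_add power_mult)
    qed
  qed
  finally show ?thesis .
qed

text \<open>Only finitely many terms contribute to each monomial, because a summable family of integers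
  has finite support.\<close>

lemma collect_coefficients:
  fixes c e :: "'i \<Rightarrow> int" and d :: "'i \<Rightarrow> nat" and F :: "complex \<Rightarrow> complex \<Rightarrow> complex"
  assumes "\<And>z q. convergence_domain z q \<Longrightarrow> ((\<lambda>i. of_int (c i) * z powi e i * q ^ d i) has_sum F z q) UNIV"
  obtains M :: "int \<Rightarrow> nat \<Rightarrow> int" where
    "\<And>z q. convergence_domain z q \<Longrightarrow> ((\<lambda>(m, n). of_int (M m n) * z powi m * q ^ n) has_sum F z q) UNIV"
proof -
  define fib where "fib = (\<lambda>(m, n). {i. e i = m \<and> d i = n})"
  have fin: "finite {i \<in> fib p. c i \<noteq> 0}" for p
  proof -
    obtain m n where p: "p = (m, n)" by fastforce
    \<comment> \<open>At this point all terms of one fibre are integers times the same nonzero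
      constant, so the integers themselves are summable.\<close>
    have "convergence_domain 1 (1/2)" by (simp add: convergence_domain_def)
    from assms[OF this] have "(\<lambda>i. of_int (c i) * 1 powi e i * (1 / 2) ^ d i :: complex) summable_on UNIV"
      by (rule has_sum_imp_summable)
    hence "(\<lambda>i. of_int (c i) * 1 powi e i * (1 / 2) ^ d i :: complex) summable_on fib p"
      by (rule summable_on_subset) auto
    also have "?this \<longleftrightarrow> (\<lambda>i. of_int (c i) * (1 / 2) ^ n :: complex) summable_on fib p"
      by (rule summable_on_cong) (auto simp: fib_def p)
    finally have "(\<lambda>i. of_int (c i) :: complex) summable_on fib p"
      by (subst (asm) summable_on_cmult_left') auto
    thus ?thesis
      by (simp only: summable_on_of_int_iff summable_on_discrete_iff)
  qed
  define M where "M = (\<lambda>m n. \<Sum>i | i \<in> fib (m, n) \<and> c i \<noteq> 0. c i)"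
  show ?thesis
  proof (rule that[of M])
    fix z q assume zq: "convergence_domain z q"
    have "((\<lambda>(p, i). of_int (c i) * z powi e i * q ^ d i) has_sum F z q) (Sigma UNIV fib)"
      using assms[OF zq]
      by (subst has_sum_reindex_bij_witness[where j = snd and i = "\<lambda>i. ((e i, d i), i)"
            and T = UNIV and h = "\<lambda>i. of_int (c i) * z powi e i * q ^ d i", OF _ _ _ _ _ refl])
         (auto simp: fib_def)
    thus "((\<lambda>(m, n). of_int (M m n) * z powi m * q ^ n) has_sum F z q) UNIV"
    proof (rule has_sum_SigmaD)
      fix p :: "int \<times> nat"
      obtain m n where p: "p = (m, n)" by fastforce
      show "((\<lambda>i. case (p, i) of (p, i) \<Rightarrow> of_int (c i) * z powi e i * q ^ d i) has_sum
               (case p of (m, n) \<Rightarrow> of_int (M m n) * z powi m * q ^ n)) (fib p)"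
      proof (rule has_sum_finite_neutralI[OF fin[of p]])
        show "(case p of (m, n) \<Rightarrow> of_int (M m n) * z powi m * q ^ n) =
          (\<Sum>i\<in>{i \<in> fib p. c i \<noteq> 0}. case (p, i) of (p, i) \<Rightarrow> of_int (c i) * z powi e i * q ^ d i)"
          by (simp add: p M_def sum_distrib_right) (rule sum.cong; auto simp: fib_def)
      qed auto
    qed
  qed
qed

section \<open>Uniqueness of the coefficients: identity theorems in q and in z\<close>

lemma powser_eq_0_imp_coeff_eq_0:
  fixes a :: "nat \<Rightarrow> complex"
  assumes r: "r > 0" and a: "\<And>x. norm x < r \<Longrightarrow> (\<lambda>n. a n * x ^ n) sums 0"
  shows "a n = 0"
proof (cases "n = 0")
  case True
  thus ?thesis using a[of 0] r by (metis norm_zero powser_sums_zero sums_unique2)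
next
  case False
  show ?thesis
  proof (rule ccontr)
    assume "a n \<noteq> 0"
    show False
    proof (rule powser_0_nonzero[of r 0 a "\<lambda>_. 0" n])
      fix s :: real assume "s > 0" and s: "\<And>z. z \<in> cball (0 :: complex) s - {0} \<Longrightarrow> (0 :: complex) \<noteq> 0"
      thus False using s[of "of_real s"] by simp
    qed (use r a False \<open>a n \<noteq> 0\<close> in auto)
  qed
qed

lemma laurent_polynomial_eq_0_imp_coeff_eq_0:
  fixes d :: "int \<Rightarrow> complex"
  assumes fin: "finite S" and d: "\<And>m. m \<notin> S \<Longrightarrow> d m = 0"
    and X: "infinite X" "0 \<notin> X" "\<And>x. x \<in> X \<Longrightarrow> (\<Sum>m\<in>S. d m * x powi m) = 0"
  shows "d m = 0"
proof -
  \<comment> \<open>Including m itself in the maximum keeps its index within 0, ..., 2N after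
    multiplication by \<open>x ^ N\<close>, even when m lies outside S.\<close>
  define N where "N = nat (Max ((\<lambda>m. \<bar>m\<bar>) ` insert m S))"
  have N: "\<bar>k\<bar> \<le> int N" if "k \<in> insert m S" for k
  proof -
    have "\<bar>k\<bar> \<le> Max ((\<lambda>m. \<bar>m\<bar>) ` insert m S)"
      by (rule Max_ge) (use fin that in auto)
    thus ?thesis unfolding N_def using abs_ge_zero[of k] by linarith
  qed
  have "(\<Sum>i\<le>2 * N. d (int i - int N) * x ^ i) = 0" if "x \<in> X" for x
  proof -
    have x0: "x \<noteq> 0" using that X by auto
    have "(\<Sum>i\<le>2 * N. d (int i - int N) * x ^ i) =
          (\<Sum>k\<in>{-int N..int N}. d k * x ^ nat (k + int N))"
      by (rule sum.reindex_bij_witness[where i = "\<lambda>k. nat (k + int N)" and j = "\<lambda>i. int i - int N"]) auto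
    also have "\<dots> = (\<Sum>k\<in>{-int N..int N}. x ^ N * (d k * x powi k))"
    proof (rule sum.cong[OF refl])
      fix k assume "k \<in> {-int N..int N}"
      hence "x ^ nat (k + int N) = x powi (k + int N)"
        by (simp add: power_int_def)
      thus "d k * x ^ nat (k + int N) = x ^ N * (d k * x powi k)"
        using x0 by (simp add: power_int_add)
    qed
    also have "\<dots> = (\<Sum>k\<in>S. x ^ N * (d k * x powi k))"
      by (rule sum.mono_neutral_right) (use N d in \<open>force simp: abs_le_iff\<close>)+
    also have "\<dots> = 0"
      using X(3)[OF that] by (simp flip: sum_distrib_left)
    finally show ?thesis .
  qed
  hence "X \<subseteq> {x. (\<Sum>i\<le>2 * N. d (int i - int N) * x ^ i) = 0}" by auto
  hence "infinite {x. (\<Sum>i\<le>2 * N. d (int i - int N) * x ^ i) = 0}"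
    using X(1) finite_subset by blast
  hence "\<forall>i\<le>2 * N. d (int i - int N) = 0"
    using polyfun_finite_roots[of "\<lambda>i. d (int i - int N)" "2 * N"] by blast
  moreover have "nat (m + int N) \<le> 2 * N" "int (nat (m + int N)) - int N = m"
    using N[of m] by auto
  ultimately show ?thesis by metis
qed

text \<open>For fixed z with 1 \<le> |z| \<le> 2 the double sum is a power series in q, so each of
  its coefficients \<open>S z n\<close> vanishes. As a function of z, \<open>S z n\<close> is a
  Laurent polynomial by integrality, and it vanishes on the whole interval [1, 2].\<close>

lemma coefficients_eq_0:
  fixes D :: "int \<Rightarrow> nat \<Rightarrow> int"
  assumes D: "\<And>z q. convergence_domain z q \<Longrightarrow> ((\<lambda>(m, n). of_int (D m n) * z powi m * q ^ n) has_sum 0) UNIV"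
  shows "D m n = 0"
proof -
  have summ: "(\<lambda>m. of_int (D m n) * z powi m) summable_on UNIV" if z: "1 \<le> norm z" "norm z \<le> 2" for z :: complex and n
  proof -
    \<comment> \<open>With |z| up to 2 the domain requires |q| < 1/2.\<close>
    have "convergence_domain z (1/4)" using z by (simp add: convergence_domain_def)
    from D[OF this] have "(\<lambda>(m, n). of_int (D m n) * z powi m * (1/4) ^ n) summable_on (UNIV \<times> UNIV)"
      by (simp add: has_sum_imp_summable)
    hence "(\<lambda>(n, m). of_int (D m n) * z powi m * (1/4) ^ n) summable_on (UNIV \<times> UNIV)"
      by (subst (asm) summable_on_swap) (simp add: case_prod_unfold)
    hence "(\<lambda>m. of_int (D m n) * z powi m * (1/4) ^ n) summable_on UNIV"
      by (rule summable_on_SigmaD1) auto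
    thus ?thesis by (subst (asm) summable_on_cmult_left') auto
  qed
  define S where "S z n = (\<Sum>\<^sub>\<infinity>m. of_int (D m n) * z powi m :: complex)" for z n
  have S0: "S z n = 0" if z: "1 \<le> norm z" "norm z \<le> 2" for z :: complex and n
  proof (rule powser_eq_0_imp_coeff_eq_0[of "1/2"])
    fix q :: complex assume q: "norm q < 1/2"
    have "norm z * norm q < 1"
      using mult_right_mono[OF z(2), of "norm q"] q by simp
    hence "convergence_domain z q" using z q by (simp add: convergence_domain_def)
    from D[OF this] have "((\<lambda>(n, m). of_int (D m n) * z powi m * q ^ n) has_sum 0) (UNIV \<times> UNIV)"
      by (subst has_sum_swap) (simp add: case_prod_unfold)
    hence "((\<lambda>n. S z n * q ^ n) has_sum 0) UNIV"
    proof (rule has_sum_SigmaD)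
      show "((\<lambda>m. case (n, m) of (n, m) \<Rightarrow> of_int (D m n) * z powi m * q ^ n) has_sum S z n * q ^ n) UNIV" for n
        using has_sum_cmult_left[OF has_sum_infsum[OF summ[OF z, of n]], of "q ^ n"]
        by (simp add: S_def)
    qed
    thus "(\<lambda>n. S z n * q ^ n) sums 0" by (rule has_sum_imp_sums)
  qed simp
  have "(\<lambda>m. of_int (D m n) :: complex) summable_on UNIV"
    using summ[of 1 n] by simp
  hence fin: "finite {m. D m n \<noteq> 0}"
    by (simp add: summable_on_of_int_iff summable_on_discrete_iff)
  have "(of_int (D m n) :: complex) = 0"
  proof (rule laurent_polynomial_eq_0_imp_coeff_eq_0[OF fin, where d = "\<lambda>m. of_int (D m n)"
        and X = "complex_of_real ` {1..2}"])
    show "infinite (complex_of_real ` {1..2})"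
      by (subst finite_image_iff) (auto simp: inj_on_def)
    show "(\<Sum>m | D m n \<noteq> 0. of_int (D m n) * x powi m) = 0" if "x \<in> complex_of_real ` {1..2}" for x
    proof -
      have x: "1 \<le> norm x" "norm x \<le> 2" using that by auto
      have "(\<Sum>m | D m n \<noteq> 0. of_int (D m n) * x powi m) = S x n"
        unfolding S_def
        by (rule infsumI[symmetric], rule has_sum_finite_neutralI[OF fin]) auto
      thus ?thesis using S0[OF x] by simp
    qed
  qed auto
  thus ?thesis by simp
qed

lemma Mbar_has_sum:
  assumes "convergence_domain z q"
  shows "((\<lambda>(m, n). of_int (Mbar m n) * z powi m * q ^ n) has_sum Mbar_gf z q) UNIV"
proof -
  define P where "P M \<longleftrightarrow> (\<forall>z q. convergence_domain z q \<longrightarrow>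
      ((\<lambda>(m, n). of_int (M m n) * z powi m * q ^ n) has_sum Mbar_gf z q) UNIV)" for M :: "int \<Rightarrow> nat \<Rightarrow> int"
  define c where "c = (\<lambda>(((m1, n1), (m2, n2)), (k, l)).
      int (qpoch_coeff m1 n1 * qpoch_coeff m2 n2 * qpoch_coeff k l) * (-1) ^ k)"
  define e where "e = (\<lambda>(((m1 :: nat, n1 :: nat), (m2 :: nat, n2 :: nat)), (k :: nat, l :: nat)). int m1 - int m2)"
  define d where "d = (\<lambda>(((m1, n1), (m2, n2)), (k :: nat, l)).
      m1 + n1 + m2 + n2 + 2 * (k choose 2) + 2 * k + 2 * l)"
  obtain M where "P M"
  proof (rule collect_coefficients[of c e d Mbar_gf])
    show "((\<lambda>i. of_int (c i) * z powi e i * q ^ d i) has_sum Mbar_gf z q) UNIV" if "convergence_domain z q" for z q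
      using Mbar_gf_expansion[OF that] by (simp add: c_def e_def d_def case_prod_unfold)
  qed (auto simp: P_def)
  moreover have "M' = M" if "P M'" for M'
  proof -
    have "((\<lambda>(m, n). of_int (M' m n - M m n) * z powi m * q ^ n) has_sum 0) UNIV" if "convergence_domain z q" for z q
    proof -
      have "((\<lambda>p. (case p of (m, n) \<Rightarrow> of_int (M' m n) * z powi m * q ^ n) +
                  - (case p of (m, n) \<Rightarrow> of_int (M m n) * z powi m * q ^ n))
              has_sum (Mbar_gf z q + - Mbar_gf z q)) UNIV"
        by (intro has_sum_add has_sum_uminusI) (use \<open>P M\<close> \<open>P M'\<close> that in \<open>auto simp: P_def\<close>)
      thus ?thesis by (simp add: case_prod_unfold algebra_simps)
    qed
    hence "M' m n - M m n = 0" for m n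
      using coefficients_eq_0[of "\<lambda>m n. M' m n - M m n"] by blast
    thus ?thesis by (intro ext) simp
  qed
  ultimately have "P (THE M. P M)" by (rule theI)
  moreover have "Mbar = (THE M. P M)"
    by (simp add: Mbar_def P_def convergence_domain_def)
  ultimately show ?thesis using assms by (simp add: P_def)
qed

theorem theorem2p10:
  fixes \<zeta> q :: complex
  assumes "\<zeta> ^ 5 = 1" and "\<forall>k\<in>{1..4::nat}. \<zeta> ^ k \<noteq> 1"
    and "norm q < 1"
  shows "(\<lambda>n. (\<Sum>\<^sub>\<infinity>m\<in>(UNIV::int set). of_int (Mbar m n) * \<zeta> powi m) * q ^ n) sums
           (Mbar05 \<zeta> (q^5) + q * Mbar15 \<zeta> (q^5) + q^2 * Mbar25 \<zeta> (q^5)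
            + q^3 * Mbar35 \<zeta> (q^5) + q^4 * Mbar45 \<zeta> (q^5))"
proof -
  have \<zeta>1: "\<zeta> \<noteq> 1" using assms(2) by (metis atLeastAtMost_iff one_le_numeral order_refl power_one)
  have "norm \<zeta> = 1" by (rule norm_root5[OF assms(1)])
  hence "convergence_domain \<zeta> q" "convergence_domain \<zeta> (1/2)" using assms(3) by (simp_all add: convergence_domain_def)
  have swap: "((\<lambda>(n, m). of_int (Mbar m n) * \<zeta> powi m * x ^ n) has_sum Mbar_gf \<zeta> x) (UNIV \<times> UNIV)"
    if "convergence_domain \<zeta> x" for x
    using Mbar_has_sum[OF that] by (subst has_sum_swap) (simp add: case_prod_unfold)
  \<comment> \<open>Here q may be 0, so summability over m is read off at 1/2, where the factor
    \<open>(1/2) ^ n\<close> can be cancelled.\<close>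
  have summ: "(\<lambda>m. of_int (Mbar m n) * \<zeta> powi m) summable_on UNIV" for n
  proof -
    have "(\<lambda>m. of_int (Mbar m n) * \<zeta> powi m * (1/2) ^ n) summable_on UNIV"
      by (rule summable_on_SigmaD1[OF has_sum_imp_summable[OF swap[OF \<open>convergence_domain \<zeta> (1/2)\<close>]]]) auto
    thus ?thesis by (subst (asm) summable_on_cmult_left') auto
  qed
  have "((\<lambda>n. (\<Sum>\<^sub>\<infinity>m. of_int (Mbar m n) * \<zeta> powi m) * q ^ n) has_sum Mbar_gf \<zeta> q) UNIV"
  proof (rule has_sum_SigmaD[OF swap[OF \<open>convergence_domain \<zeta> q\<close>]])
    show "((\<lambda>m. case (n, m) of (n, m) \<Rightarrow> of_int (Mbar m n) * \<zeta> powi m * q ^ n) has_sum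
            (\<Sum>\<^sub>\<infinity>m. of_int (Mbar m n) * \<zeta> powi m) * q ^ n) UNIV" for n
      using has_sum_cmult_left[OF has_sum_infsum[OF summ[of n]], of "q ^ n"] by simp
  qed
  thus ?thesis
    unfolding Mbar_gf_5_dissection[OF assms(3,1) \<zeta>1] by (rule has_sum_imp_sums)
qed

end
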